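(* Let $X$ be a two-sided quaternionic Banach space, let $T\in\mathcal{B}_R(X)$, and let $i\in\mathbb{S}$ be fixed. Let $T_i$ be the operator $T$ regarded as a bounded linear operator on the complex Banach space $X_i$. Then $$\sigma_S(T)=[\sigma(T_i)],$$ where $\sigma(T_i)\subset\mathbb{C}_i$ is the usual spectrum of $T_i$ and $[\sigma(T_i)]=\bigcup_{q\in\sigma(T_i)}[q]$.
   Context: $\mathbb{H}$ denotes the quaternions and $\mathbb{S}=\{q\in\mathbb{H}:q^2=-1\}$. For $j\in\mathbb{S}$, $\mathbb{C}_j=\{\alpha+\beta j:\alpha,\beta\in\mathbb{R}\}$. For $q\in\mathbb{H}$, $[q]=\{\mathrm{Re}(q)+|\mathrm{Im}(q)|j: j\in\mathbb{S}\}$ is the set of quaternions conjugate to $q$. A two-sided quaternionic Banach space $X$ is an abelian group which is both a left and a right $\mathbb{H}$-vector space, with $rx=xr$ for $r\in\mathbb{R}$ and $(px)q=p(xq)$ for $p,q\in\mathbb{H}$, complete for a norm with $\|qx\|=\|xq\|=|q|\,\|x\|$. $\mathcal{B}_R(X)$ is the set of bounded right $\mathbb{H}$-linear operators $T:X\to X$ (additive, $T(xq)=(Tx)q$). For $q\in\mathbb{H}$, $Q_q(T)=T^2-2\mathrm{Re}(q)T+|q|^2I$. The S-spectrum is $\sigma_S(T)=\{q\in\mathbb{H}: Q_q(T)\text{ is not invertible in }\mathcal{B}_R(X)\}$. For fixed $i\in\mathbb{S}$, identify $\mathbb{C}_i$ with $\mathbb{C}$; $X_i$ is $X$ viewed as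 a complex Banach space with its addition and norm, complex scalar multiplication being the right multiplication of $X$ restricted to $\mathbb{C}_i$. $T_i$ is the bounded complex linear operator on $X_i$ given by $T_i(x)=T(x)$. *)

theory Defs
  imports "HOL-Analysis.Analysis"
begin

section \<open>Quaternions\<close>

datatype quat = Quat (qRe: real) (qI: real) (qJ: real) (qK: real)

lemma quat_eq_iff: "p = q \<longleftrightarrow> qRe p = qRe q \<and> qI p = qI q \<and> qJ p = qJ q \<and> qK p = qK q"
  by (cases p; cases q) auto

instantiation quat :: "{ring_1, inverse}"
begin

definition "0 = Quat 0 0 0 0"
definition "1 = Quat 1 0 0 0"
definition "p + q = Quat (qRe p + qRe q) (qI p + qI q) (qJ p + qJ q) (qK p + qK q)" for p q :: quat
definition "p - q = Quat (qRe p - qRe q) (qI p - qI q) (qJ p - qJ q) (qK p - qK q)" for p q :: quat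
definition "- q = Quat (- qRe q) (- qI q) (- qJ q) (- qK q)" for q :: quat
definition "p * q = Quat
   (qRe p * qRe q - qI p * qI q - qJ p * qJ q - qK p * qK q)
   (qRe p * qI q + qI p * qRe q + qJ p * qK q - qK p * qJ q)
   (qRe p * qJ q - qI p * qK q + qJ p * qRe q + qK p * qI q)
   (qRe p * qK q + qI p * qJ q - qJ p * qI q + qK p * qRe q)" for p q :: quat
definition "inverse q =
   (let n = (qRe q)\<^sup>2 + (qI q)\<^sup>2 + (qJ q)\<^sup>2 + (qK q)\<^sup>2
    in Quat (qRe q / n) (- qI q / n) (- qJ q / n) (- qK q / n))" for q :: quat
definition "p div q = p * inverse q" for p q :: quat

instance
  by intro_classes
     (simp_all add: quat_eq_iff zero_quat_def one_quat_def plus_quat_def minus_quat_def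
        uminus_quat_def times_quat_def algebra_simps)

end

lemma quat_sel [simp]:
  "qRe 0 = 0" "qI 0 = 0" "qJ 0 = 0" "qK 0 = 0"
  "qRe 1 = 1" "qI 1 = 0" "qJ 1 = 0" "qK 1 = 0"
  "qRe (p + q) = qRe p + qRe q" "qI (p + q) = qI p + qI q"
  "qJ (p + q) = qJ p + qJ q" "qK (p + q) = qK p + qK q"
  "qRe (p - q) = qRe p - qRe q" "qI (p - q) = qI p - qI q"
  "qJ (p - q) = qJ p - qJ q" "qK (p - q) = qK p - qK q"
  "qRe (- q) = - qRe q" "qI (- q) = - qI q" "qJ (- q) = - qJ q" "qK (- q) = - qK q"
  "qRe (p * q) = qRe p * qRe q - qI p * qI q - qJ p * qJ q - qK p * qK q"
  "qI (p * q) = qRe p * qI q + qI p * qRe q + qJ p * qK q - qK p * qJ q"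
  "qJ (p * q) = qRe p * qJ q - qI p * qK q + qJ p * qRe q + qK p * qI q"
  "qK (p * q) = qRe p * qK q + qI p * qJ q - qJ p * qI q + qK p * qRe q"
  by (simp_all add: zero_quat_def one_quat_def plus_quat_def minus_quat_def
        uminus_quat_def times_quat_def)

lemma quat_sumsq_eq_0_iff:
  "(qRe q)\<^sup>2 + (qI q)\<^sup>2 + (qJ q)\<^sup>2 + (qK q)\<^sup>2 = 0 \<longleftrightarrow> q = 0"
  by (simp add: quat_eq_iff add_nonneg_eq_0_iff)

instance quat :: division_ring
proof
  fix p q :: quat
  let ?n = "(qRe q)\<^sup>2 + (qI q)\<^sup>2 + (qJ q)\<^sup>2 + (qK q)\<^sup>2"
  have *: "qRe q * qRe q + qI q * qI q + qJ q * qJ q + qK q * qK q = ?n"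
    by (simp add: power2_eq_square)
  show "inverse (0::quat) = 0"
    by (simp add: inverse_quat_def quat_eq_iff)
  show "p / q = p * inverse q"
    by (simp add: divide_quat_def)
  assume "q \<noteq> 0"
  then have n: "?n \<noteq> 0" by (simp only: quat_sumsq_eq_0_iff not_False_eq_True)
  show "inverse q * q = 1" "q * inverse q = 1"
    using n * unfolding inverse_quat_def Let_def quat_eq_iff
    by (simp_all add: diff_divide_distrib [symmetric] add_divide_distrib [symmetric] algebra_simps)
qed

instantiation quat :: real_normed_div_algebra
begin

definition "r *\<^sub>R q = Quat (r * qRe q) (r * qI q) (r * qJ q) (r * qK q)" for q :: quat
definition "norm q = sqrt ((qRe q)\<^sup>2 + (qI q)\<^sup>2 + (qJ q)\<^sup>2 + (qK q)\<^sup>2)" for q :: quat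
definition "sgn q = inverse (norm q) *\<^sub>R q" for q :: quat
definition "dist p q = norm (p - q)" for p q :: quat
definition [code del]:
  "(uniformity :: (quat \<times> quat) filter) = (INF e\<in>{0<..}. principal {(x, y). dist x y < e})"
definition [code del]:
  "open (U :: quat set) \<longleftrightarrow> (\<forall>x\<in>U. eventually (\<lambda>(x', y). x' = x \<longrightarrow> y \<in> U) uniformity)"

instance
proof
  fix p q :: quat and r s :: real and U :: "quat set"
  show "r *\<^sub>R (p + q) = r *\<^sub>R p + r *\<^sub>R q" "(r + s) *\<^sub>R q = r *\<^sub>R q + s *\<^sub>R q"
    "r *\<^sub>R s *\<^sub>R q = (r * s) *\<^sub>R q" "1 *\<^sub>R q = q"
    "r *\<^sub>R p * q = r *\<^sub>R (p * q)" "p * r *\<^sub>R q = r *\<^sub>R (p * q)"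
    by (simp_all add: quat_eq_iff scaleR_quat_def algebra_simps)
  show "dist p q = norm (p - q)" by (rule dist_quat_def)
  show "sgn q = inverse (norm q) *\<^sub>R q" by (rule sgn_quat_def)
  show "(uniformity :: (quat \<times> quat) filter) = (INF e\<in>{0<..}. principal {(x, y). dist x y < e})"
    by (rule uniformity_quat_def)
  show "open U \<longleftrightarrow> (\<forall>x\<in>U. eventually (\<lambda>(x', y). x' = x \<longrightarrow> y \<in> U) uniformity)"
    by (rule open_quat_def)
  show "norm q = 0 \<longleftrightarrow> q = 0"
    unfolding norm_quat_def real_sqrt_eq_0_iff by (rule quat_sumsq_eq_0_iff)
  have norm4: "norm q = norm ((qRe q, qI q), (qJ q, qK q))" for q :: quat
    by (simp add: norm_quat_def norm_Pair)
  show "norm (p + q) \<le> norm p + norm q"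
    unfolding norm4 using norm_triangle_ineq [of "((qRe p, qI p), (qJ p, qK p))"] by fastforce
  show "norm (r *\<^sub>R q) = \<bar>r\<bar> * norm q"
    by (simp add: norm_quat_def scaleR_quat_def power_mult_distrib distrib_left [symmetric]
        real_sqrt_mult)
  show "norm (p * q) = norm p * norm q"
    unfolding norm_quat_def real_sqrt_mult [symmetric]
    by (rule arg_cong [where f = sqrt]) (simp, algebra)
qed

end

definition qIm :: "quat \<Rightarrow> quat" where
  "qIm q = q - of_real (qRe q)"

definition imag_units :: "quat set" where
  "imag_units = {q. q\<^sup>2 = -1}"

definition conj_sphere :: "quat \<Rightarrow> quat set" where
  "conj_sphere q = {of_real (qRe q) + of_real (norm (qIm q)) * j | j. j \<in> imag_units}"

text \<open>The identification of the complex numbers with the slice spanned by 1 and \<open>i\<close>.\<close>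
definition slice :: "quat \<Rightarrow> complex \<Rightarrow> quat" where
  "slice i z = of_real (Re z) + of_real (Im z) * i"


section \<open>Operators on quaternionic and complex Banach spaces\<close>

text \<open>The additive group, the norm and completeness come from the class \<open>banach\<close>; the two
  \<open>of_real\<close> axioms say that left and right multiplication by reals agree, and identify them
  with the real scaling of the class.\<close>
locale two_sided_quat_banach =
  fixes lmult :: "quat \<Rightarrow> 'a::banach \<Rightarrow> 'a"
    and rmult :: "'a \<Rightarrow> quat \<Rightarrow> 'a"
  assumes lmult_add_right: "lmult q (x + y) = lmult q x + lmult q y"
    and lmult_add_left: "lmult (p + q) x = lmult p x + lmult q x"
    and lmult_mult: "lmult (p * q) x = lmult p (lmult q x)"
    and rmult_add_left: "rmult (x + y) q = rmult x q + rmult y q"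
    and rmult_add_right: "rmult x (p + q) = rmult x p + rmult x q"
    and rmult_mult: "rmult x (p * q) = rmult (rmult x p) q"
    and lmult_of_real: "lmult (of_real r) x = r *\<^sub>R x"
    and rmult_of_real: "rmult x (of_real r) = r *\<^sub>R x"
    and lmult_rmult: "rmult (lmult p x) q = lmult p (rmult x q)"
    and norm_lmult: "norm (lmult q x) = norm q * norm x"
    and norm_rmult: "norm (rmult x q) = norm q * norm x"

locale complex_banach = vector_space cscale
  for cscale :: "complex \<Rightarrow> 'a::banach \<Rightarrow> 'a" +
  assumes norm_cscale: "norm (cscale c x) = norm c * norm x"

definition invertible_in :: "('a \<Rightarrow> 'a) set \<Rightarrow> ('a \<Rightarrow> 'a) \<Rightarrow> bool" where
  "invertible_in \<B> A \<longleftrightarrow> A \<in> \<B> \<and> (\<exists>B\<in>\<B>. B \<circ> A = id \<and> A \<circ> B = id)"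

definition right_bounded_ops :: "('a::banach \<Rightarrow> quat \<Rightarrow> 'a) \<Rightarrow> ('a \<Rightarrow> 'a) set" where
  "right_bounded_ops rmult = {T. (\<forall>x y. T (x + y) = T x + T y) \<and>
     (\<forall>x q. T (rmult x q) = rmult (T x) q) \<and> (\<exists>C. \<forall>x. norm (T x) \<le> C * norm x)}"

definition complex_bounded_ops :: "(complex \<Rightarrow> 'a::banach \<Rightarrow> 'a) \<Rightarrow> ('a \<Rightarrow> 'a) set" where
  "complex_bounded_ops cscale =
     {T. Vector_Spaces.linear cscale cscale T \<and> (\<exists>C. \<forall>x. norm (T x) \<le> C * norm x)}"

definition Q_op :: "('a::banach \<Rightarrow> 'a) \<Rightarrow> quat \<Rightarrow> 'a \<Rightarrow> 'a" where
  "Q_op T q = (\<lambda>x. T (T x) - (2 * qRe q) *\<^sub>R T x + (norm q)\<^sup>2 *\<^sub>R x)"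

definition S_spectrum :: "('a::banach \<Rightarrow> quat \<Rightarrow> 'a) \<Rightarrow> ('a \<Rightarrow> 'a) \<Rightarrow> quat set" where
  "S_spectrum rmult T = {q. \<not> invertible_in (right_bounded_ops rmult) (Q_op T q)}"

definition complex_spectrum :: "(complex \<Rightarrow> 'a::banach \<Rightarrow> 'a) \<Rightarrow> ('a \<Rightarrow> 'a) \<Rightarrow> complex set" where
  "complex_spectrum cscale A =
     {z. \<not> invertible_in (complex_bounded_ops cscale) (\<lambda>x. A x - cscale z x)}"

text \<open>The complex Banach space attached to \<open>i\<close> is \<open>'a\<close> itself with this scalar multiplication,
  so the operator induced on it by \<open>T\<close> is the function \<open>T\<close>.\<close>
definition slice_scale :: "('a \<Rightarrow> quat \<Rightarrow> 'a) \<Rightarrow> quat \<Rightarrow> complex \<Rightarrow> 'a \<Rightarrow> 'a" where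
  "slice_scale rmult i z x = rmult x (slice i z)"


section \<open>The complex Banach space attached to an imaginary unit\<close>

lemma slice_add: "slice i (z + w) = slice i z + slice i w"
  by (simp add: slice_def algebra_simps)

lemma slice_mult:
  assumes "i \<in> imag_units"
  shows "slice i (z * w) = slice i z * slice i w"
proof -
  have ii: "i * i = -1"
    using assms by (simp add: imag_units_def power2_eq_square)
  show ?thesis
    unfolding slice_def of_real_def
    by (simp add: algebra_simps ii)
qed

lemma norm_imag_unit:
  assumes "i \<in> imag_units"
  shows "norm i = 1"
proof -
  have "(norm i)\<^sup>2 = 1"
    using assms by (simp add: imag_units_def norm_power [symmetric])
  then show ?thesis
    by (simp add: power2_eq_1_iff) (metis norm_ge_zero neg_0_le_iff_le not_one_le_zero)
qed

lemma imag_unit_qRe: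
  assumes "i \<in> imag_units"
  shows "qRe i = 0"
proof (rule ccontr)
  assume r: "qRe i \<noteq> 0"
  have "i * i = -1"
    using assms by (simp add: imag_units_def power2_eq_square)
  then have e: "qRe i * qRe i - qI i * qI i - qJ i * qJ i - qK i * qK i = -1"
    "2 * (qRe i * qI i) = 0" "2 * (qRe i * qJ i) = 0" "2 * (qRe i * qK i) = 0"
    by (auto simp add: quat_eq_iff)
  then have "qRe i * qRe i = -1" using r by simp
  then show False by (metis not_one_le_zero neg_0_le_iff_le zero_le_square)
qed

lemma qRe_of_real [simp]: "qRe (of_real r) = r" "qI (of_real r) = 0" "qJ (of_real r) = 0"
  "qK (of_real r) = 0"
  by (simp_all add: of_real_def scaleR_quat_def)

lemma norm_slice:
  assumes "i \<in> imag_units"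
  shows "norm (slice i z) = norm z"
proof -
  have "(norm i)\<^sup>2 = 1" using norm_imag_unit [OF assms] by simp
  then have "(qI i)\<^sup>2 + (qJ i)\<^sup>2 + (qK i)\<^sup>2 = 1"
    by (simp add: norm_quat_def imag_unit_qRe [OF assms])
  moreover have "(norm (slice i z))\<^sup>2 = (Re z)\<^sup>2 + (Im z)\<^sup>2 * ((qI i)\<^sup>2 + (qJ i)\<^sup>2 + (qK i)\<^sup>2)"
    by (simp add: norm_quat_def slice_def imag_unit_qRe [OF assms] power_mult_distrib algebra_simps)
  ultimately have "(norm (slice i z))\<^sup>2 = (norm z)\<^sup>2"
    by (simp add: cmod_power2)
  then show ?thesis by simp
qed

context two_sided_quat_banach
begin

lemma complex_banach_slice:
  assumes "i \<in> imag_units"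
  shows "complex_banach (slice_scale rmult i)"
proof
  have one: "slice i 1 = of_real 1" by (simp add: slice_def)
  show "slice_scale rmult i 1 x = x" for x
    unfolding slice_scale_def one rmult_of_real by simp
  show "slice_scale rmult i a (slice_scale rmult i b x) = slice_scale rmult i (a * b) x" for a b x
    using slice_mult [OF assms, of b a] by (simp add: slice_scale_def rmult_mult mult.commute)
qed (simp_all add: slice_scale_def slice_add rmult_add_left rmult_add_right norm_rmult
      norm_slice [OF assms])

lemma complex_bounded_ops_slice:
  assumes "i \<in> imag_units" "T \<in> right_bounded_ops rmult"
  shows "T \<in> complex_bounded_ops (slice_scale rmult i)"
proof -
  interpret complex_banach "slice_scale rmult i"
    using assms(1) by (rule complex_banach_slice)
  have "Vector_Spaces.linear (slice_scale rmult i) (slice_scale rmult i) T"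
    using assms(2) by unfold_locales (auto simp: right_bounded_ops_def slice_scale_def)
  then show ?thesis
    using assms(2) by (auto simp: right_bounded_ops_def complex_bounded_ops_def)
qed

end

end

theory Submission
  imports Defs
begin

text \<open>Let \<open>z = Re q + \<bar>Im q\<bar> i\<close>, acting on \<open>X\<close> from the right. Since \<open>T\<close> commutes with this action,
  \<open>Q\<^sub>q(T)\<close> factors as the product of the commuting complex linear operators \<open>T - z\<close> and
  \<open>T - cnj z\<close>, so it is invertible over the complex numbers iff both factors are. A complex
  linear inverse of \<open>Q\<^sub>q(T)\<close> is automatically right linear over the quaternions, so it is
  irrelevant which of the two algebras is used. Finally \<open>q\<close> lies in the sphere of \<open>w\<close> iff
  \<open>w = z\<close> or \<open>w = cnj z\<close>.\<close>

section \<open>Invertibility in a set of maps closed under composition\<close>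

lemma invertible_in_comp:
  assumes "\<And>A B. A \<in> \<B> \<Longrightarrow> B \<in> \<B> \<Longrightarrow> A \<circ> B \<in> \<B>"
    and "invertible_in \<B> A" "invertible_in \<B> B"
  shows "invertible_in \<B> (A \<circ> B)"
proof -
  obtain A' B' where A': "A' \<in> \<B>" "A' \<circ> A = id" "A \<circ> A' = id"
    and B': "B' \<in> \<B>" "B' \<circ> B = id" "B \<circ> B' = id"
    using assms(2,3) unfolding invertible_in_def by blast
  have "(B' \<circ> A') \<circ> (A \<circ> B) = id" "(A \<circ> B) \<circ> (B' \<circ> A') = id"
    using A' B' by (simp_all add: fun_eq_iff)
  then show ?thesis
    using assms A'(1) B'(1) unfolding invertible_in_def by blast
qed

text \<open>If \<open>C\<close> inverts \<open>A \<circ> B\<close>, then \<open>B \<circ> C\<close>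
  is a right inverse of \<open>A\<close> at once; commutation makes it a left inverse too.\<close>

lemma invertible_in_left_factor:
  assumes closed: "\<And>A B. A \<in> \<B> \<Longrightarrow> B \<in> \<B> \<Longrightarrow> A \<circ> B \<in> \<B>"
    and A: "A \<in> \<B>" and B: "B \<in> \<B>" and comm: "A \<circ> B = B \<circ> A"
    and inv: "invertible_in \<B> (A \<circ> B)"
  shows "invertible_in \<B> A"
proof -
  obtain C where C: "C \<in> \<B>" "C \<circ> (A \<circ> B) = id" "(A \<circ> B) \<circ> C = id"
    using inv unfolding invertible_in_def by blast
  have AB: "A (B x) = B (A x)" for x
    using comm by (simp add: fun_eq_iff)
  have CAB: "C (A (B x)) = x" "A (B (C x)) = x" for x
    using C(2,3) by (simp_all add: fun_eq_iff)
  \<comment> \<open>Since \<open>A\<close> commutes with \<open>A \<circ> B\<close>, it commutes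
    with the inverse \<open>C\<close>. Hence
    \<open>B (C (A x)) = B (A (C x)) = A (B (C x)) = x\<close>.\<close>
  have "B (C (A x)) = x" for x
    by (metis AB CAB)
  then have "(B \<circ> C) \<circ> A = id" "A \<circ> (B \<circ> C) = id"
    using CAB(2) by (simp_all add: fun_eq_iff)
  then show ?thesis
    using A closed [OF B C(1)] unfolding invertible_in_def by blast
qed

lemma invertible_in_comp_iff:
  assumes "\<And>A B. A \<in> \<B> \<Longrightarrow> B \<in> \<B> \<Longrightarrow> A \<circ> B \<in> \<B>"
    and "A \<in> \<B>" "B \<in> \<B>" "A \<circ> B = B \<circ> A"
  shows "invertible_in \<B> (A \<circ> B) \<longleftrightarrow> invertible_in \<B> A \<and> invertible_in \<B> B"
proof
  assume inv: "invertible_in \<B> (A \<circ> B)"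
  show "invertible_in \<B> A \<and> invertible_in \<B> B"
  proof
    show "invertible_in \<B> A"
      using assms inv by (rule invertible_in_left_factor)
    show "invertible_in \<B> B"
      using assms(1,3,2) assms(4) [symmetric] inv [unfolded assms(4)]
      by (rule invertible_in_left_factor)
  qed
qed (use invertible_in_comp [OF assms(1)] in blast)

section \<open>Norm bounds for composites and differences\<close>

lemma bounded_comp:
  assumes "\<exists>C. \<forall>x. norm (f x) \<le> C * norm x" "\<exists>C. \<forall>x. norm (g x) \<le> C * norm x"
  shows "\<exists>C. \<forall>x. norm (f (g x)) \<le> C * norm x"
proof -
  obtain C D where C: "\<And>x. norm (f x) \<le> C * norm x" and D: "\<And>x. norm (g x) \<le> D * norm x"
    using assms by blast
  \<comment> \<open>\<open>C\<close> is not assumed nonnegative, and the bound on \<open>g x\<close>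
    has to be multiplied by it.\<close>
  have "norm (f (g x)) \<le> (\<bar>C\<bar> * D) * norm x" for x
  proof -
    have "norm (f (g x)) \<le> \<bar>C\<bar> * norm (g x)"
      using C [of "g x"] by (meson abs_ge_self mult_right_mono norm_ge_zero order_trans)
    also have "\<dots> \<le> \<bar>C\<bar> * (D * norm x)"
      using D by (intro mult_left_mono) auto
    finally show ?thesis by (simp add: mult.assoc)
  qed
  then show ?thesis by blast
qed

lemma bounded_diff:
  assumes "\<exists>C. \<forall>x. norm (f x) \<le> C * norm x" "\<exists>C. \<forall>x. norm (g x) \<le> C * norm x"
  shows "\<exists>C. \<forall>x. norm (f x - g x) \<le> C * norm x"
proof -
  obtain C D where C: "\<And>x. norm (f x) \<le> C * norm x" and D: "\<And>x. norm (g x) \<le> D * norm x"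
    using assms by blast
  have "norm (f x - g x) \<le> (C + D) * norm x" for x
    using norm_triangle_ineq4 [of "f x" "g x"] C [of x] D [of x] by (simp add: distrib_right)
  then show ?thesis by blast
qed

section \<open>Polar form of quaternions and conjugacy spheres\<close>

lemma quat_real_mult_commute: "of_real r * q = q * of_real r" for q :: quat
  by (simp add: of_real_def)

lemma qRe_slice: "i \<in> imag_units \<Longrightarrow> qRe (slice i z) = Re z"
  by (simp add: slice_def imag_unit_qRe)

lemma norm_qIm_slice:
  assumes "i \<in> imag_units"
  shows "norm (qIm (slice i z)) = \<bar>Im z\<bar>"
proof -
  have "qIm (slice i z) = of_real (Im z) * i"
    unfolding qIm_def qRe_slice [OF assms] by (simp add: slice_def)
  then show ?thesis
    by (simp add: norm_mult norm_imag_unit [OF assms])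
qed

lemma norm_quat_square: "(norm q)\<^sup>2 = (qRe q)\<^sup>2 + (norm (qIm q))\<^sup>2"
  by (simp add: norm_quat_def qIm_def)

text \<open>Distinct basis units anticommute, so the mixed products cancel. This is what makes a
  normalised nonzero imaginary part an imaginary unit.\<close>

lemma qIm_square: "(qIm q)\<^sup>2 = - of_real ((norm (qIm q))\<^sup>2)"
proof -
  have "(norm (qIm q))\<^sup>2 = (qI q)\<^sup>2 + (qJ q)\<^sup>2 + (qK q)\<^sup>2"
    by (simp add: norm_quat_def qIm_def)
  then show ?thesis
    by (simp only:) (simp add: quat_eq_iff qIm_def power2_eq_square)
qed

lemma quat_polar:
  obtains j where "j \<in> imag_units" "q = of_real (qRe q) + of_real (norm (qIm q)) * j"
proof (cases "qIm q = 0")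
  case True
  \<comment> \<open>For real \<open>q\<close> the unit is multiplied by zero, so any choice
    serves.\<close>
  have "Quat 0 1 0 0 \<in> imag_units"
    by (simp add: imag_units_def power2_eq_square quat_eq_iff)
  moreover have "q = of_real (qRe q) + of_real (norm (qIm q)) * Quat 0 1 0 0"
    using True by (simp add: qIm_def)
  ultimately show ?thesis by (rule that)
next
  case False
  let ?n = "norm (qIm q)"
  let ?j = "inverse ?n *\<^sub>R qIm q"
  have "?j\<^sup>2 = (inverse ?n)\<^sup>2 *\<^sub>R (qIm q)\<^sup>2"
    by (simp add: power2_eq_square)
  also have "\<dots> = -1"
    unfolding qIm_square using False by (simp add: of_real_def flip: power_mult_distrib)
  finally have "?j \<in> imag_units"
    by (simp add: imag_units_def)
  moreover have "q = of_real (qRe q) + of_real ?n * ?j"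
    using False by (simp add: of_real_def) (simp add: qIm_def of_real_def)
  ultimately show ?thesis by (rule that)
qed

text \<open>Points of the sphere lie in slices, where both quantities can be read off; conversely,
  the polar form of \<open>q\<close> supplies the unit.\<close>

lemma mem_conj_sphere_iff:
  "q \<in> conj_sphere p \<longleftrightarrow> qRe q = qRe p \<and> norm (qIm q) = norm (qIm p)"
proof
  assume "q \<in> conj_sphere p"
  then obtain j where j: "j \<in> imag_units"
    and q: "q = slice j (Complex (qRe p) (norm (qIm p)))"
    by (auto simp: conj_sphere_def slice_def)
  show "qRe q = qRe p \<and> norm (qIm q) = norm (qIm p)"
    unfolding q qRe_slice [OF j] norm_qIm_slice [OF j] by simp
next
  assume "qRe q = qRe p \<and> norm (qIm q) = norm (qIm p)"
  then show "q \<in> conj_sphere p"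
    using quat_polar [of q] by (auto simp: conj_sphere_def)
qed

text \<open>Membership fixes \<open>Re w\<close> and the absolute value of \<open>Im w\<close>,
  leaving only the sign of \<open>Im w\<close> free.\<close>

lemma mem_conj_sphere_slice_iff:
  assumes "i \<in> imag_units" and z: "z = Complex (qRe q) (norm (qIm q))"
  shows "q \<in> conj_sphere (slice i w) \<longleftrightarrow> w = z \<or> w = cnj z"
  unfolding mem_conj_sphere_iff qRe_slice [OF assms(1)] norm_qIm_slice [OF assms(1)]
  by (auto simp: z complex_eq_iff abs_if)

section \<open>Bounded complex linear operators\<close>

context complex_banach
begin

lemma complex_bounded_ops_comp:
  assumes "A \<in> complex_bounded_ops cscale" "B \<in> complex_bounded_ops cscale"
  shows "A \<circ> B \<in> complex_bounded_ops cscale"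
  using assms bounded_comp [of A B]
  by (auto simp: complex_bounded_ops_def intro: Vector_Spaces.linear_compose)

lemma complex_bounded_ops_diff_scale:
  assumes "A \<in> complex_bounded_ops cscale"
  shows "(\<lambda>x. A x - cscale z x) \<in> complex_bounded_ops cscale"
proof -
  interpret vector_space_pair cscale cscale ..
  have "\<exists>C. \<forall>x. norm (cscale z x) \<le> C * norm x"
    using norm_cscale by (metis order_refl)
  then show ?thesis
    using assms bounded_diff [of A "cscale z"]
    by (auto simp: complex_bounded_ops_def intro: linear_compose_sub linear_scale_self)
qed

end

section \<open>Right linear operators and their passage to a slice\<close>

context two_sided_quat_banach
begin

lemma rmult_diff_left: "rmult (x - y) q = rmult x q - rmult y q"
  by (metis add_diff_cancel_right' diff_add_cancel rmult_add_left)

lemma rmult_scaleR: "rmult (r *\<^sub>R x) q = r *\<^sub>R rmult x q"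
  by (metis quat_real_mult_commute rmult_mult rmult_of_real)

lemma right_bounded_ops_diff:
  assumes "T \<in> right_bounded_ops rmult"
  shows "T (x - y) = T x - T y"
proof -
  have "T (x - y) + T y = T x"
    using assms unfolding right_bounded_ops_def mem_Collect_eq by (metis diff_add_cancel)
  then show ?thesis by (simp add: eq_diff_eq)
qed

lemma Q_op_right_bounded:
  assumes T: "T \<in> right_bounded_ops rmult"
  shows "Q_op T q \<in> right_bounded_ops rmult"
proof -
  have add: "T (x + y) = T x + T y" and scale: "T (rmult x p) = rmult (T x) p" for x y p
    using T by (auto simp: right_bounded_ops_def)
  have bdd: "\<exists>C. \<forall>x. norm (T x) \<le> C * norm x"
    using T by (auto simp: right_bounded_ops_def)
  have scaleR_bdd: "\<exists>C. \<forall>x. norm (r *\<^sub>R x) \<le> C * norm x" for r :: real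
    by (metis norm_scaleR order_refl)
  have "\<exists>C. \<forall>x. norm (Q_op T q x) \<le> C * norm x"
    \<comment> \<open>The last summand of \<open>Q_op\<close> is treated as subtraction of a
      negative multiple, so that the bound for differences applies twice.\<close>
    using bounded_diff [OF bounded_diff [OF bounded_comp [OF bdd bdd]
          bounded_comp [OF scaleR_bdd [of "2 * qRe q"] bdd]] scaleR_bdd [of "- (norm q)\<^sup>2"]]
    by (simp add: Q_op_def)
  then show ?thesis
    by (simp add: right_bounded_ops_def Q_op_def add scale rmult_add_left rmult_diff_left
        rmult_scaleR scaleR_add_right)
qed

lemma invertible_in_right_iff_slice:
  assumes i: "i \<in> imag_units" and A: "A \<in> right_bounded_ops rmult"
  shows "invertible_in (right_bounded_ops rmult) A \<longleftrightarrow>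
    invertible_in (complex_bounded_ops (slice_scale rmult i)) A"
proof
  assume "invertible_in (right_bounded_ops rmult) A"
  then show "invertible_in (complex_bounded_ops (slice_scale rmult i)) A"
    using complex_bounded_ops_slice [OF i] unfolding invertible_in_def by blast
next
  assume "invertible_in (complex_bounded_ops (slice_scale rmult i)) A"
  then obtain B where B: "B \<in> complex_bounded_ops (slice_scale rmult i)"
    and inv: "B \<circ> A = id" "A \<circ> B = id"
    unfolding invertible_in_def by blast
  have BA: "B (A x) = x" and AB: "A (B x) = x" for x
    using inv by (simp_all add: fun_eq_iff)
  have add: "A (x + y) = A x + A y" and scale: "A (rmult x q) = rmult (A x) q" for x y q
    using A by (auto simp: right_bounded_ops_def)
  \<comment> \<open>Write the arguments as \<open>A (B x)\<close> and \<open>A (B y)\<close>, use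
    the law for \<open>A\<close>, then cancel \<open>B\<close> against \<open>A\<close>. Only the
    norm bound is taken from the complex side.\<close>
  have "B (x + y) = B x + B y" for x y
    by (metis add AB BA)
  moreover have "B (rmult x q) = rmult (B x) q" for x q
    by (metis scale AB BA)
  ultimately have "B \<in> right_bounded_ops rmult"
    using B by (auto simp: right_bounded_ops_def complex_bounded_ops_def)
  then show "invertible_in (right_bounded_ops rmult) A"
    using A inv unfolding invertible_in_def by blast
qed

text \<open>Expand the product: scalars commute with \<open>T\<close>, \<open>z + cnj z\<close> is
  \<open>2 * qRe q\<close>, and \<open>z * cnj z\<close> is the squared norm of \<open>q\<close>.
  The conditions on \<open>z\<close> are invariant under conjugation, so the factors may also be
  taken in the opposite order.\<close>

lemma Q_op_factor:
  assumes i: "i \<in> imag_units" and T: "T \<in> right_bounded_ops rmult"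
    and z: "Re z = qRe q" "norm z = norm q"
  shows "Q_op T q = (\<lambda>x. T x - slice_scale rmult i z x) \<circ> (\<lambda>x. T x - slice_scale rmult i (cnj z) x)"
proof
  fix x
  interpret complex_banach "slice_scale rmult i"
    using i by (rule complex_banach_slice)
  let ?s = "slice_scale rmult i"
  have real: "?s (of_real r) y = r *\<^sub>R y" for r y
    by (simp add: slice_scale_def slice_def rmult_of_real)
  have comm: "T (?s w y) = ?s w (T y)" for w y
    using T by (simp add: right_bounded_ops_def slice_scale_def)
  have "?s z (T x) + ?s (cnj z) (T x) = (2 * qRe q) *\<^sub>R T x"
    using real [of "2 * qRe q" "T x"] complex_add_cnj [of z] z(1)
    by (simp flip: scale_left_distrib)
  moreover have "?s z (?s (cnj z) x) = (norm q)\<^sup>2 *\<^sub>R x"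
    using real [of "(norm q)\<^sup>2" x] by (simp add: z(2) flip: complex_norm_square)
  moreover have "T (T x - ?s (cnj z) x) - ?s z (T x - ?s (cnj z) x) =
      T (T x) - (?s z (T x) + ?s (cnj z) (T x)) + ?s z (?s (cnj z) x)"
    by (simp add: right_bounded_ops_diff [OF T] comm scale_right_diff_distrib)
  ultimately show "Q_op T q x = ((\<lambda>x. T x - ?s z x) \<circ> (\<lambda>x. T x - ?s (cnj z) x)) x"
    by (simp add: Q_op_def)
qed

lemma mem_S_spectrum_iff:
  assumes i: "i \<in> imag_units" and T: "T \<in> right_bounded_ops rmult"
    and z: "z = Complex (qRe q) (norm (qIm q))"
  shows "q \<in> S_spectrum rmult T \<longleftrightarrow>
    z \<in> complex_spectrum (slice_scale rmult i) T \<or> cnj z \<in> complex_spectrum (slice_scale rmult i) T"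
proof -
  interpret complex_banach "slice_scale rmult i"
    using i by (rule complex_banach_slice)
  let ?\<B> = "complex_bounded_ops (slice_scale rmult i)"
  let ?A = "\<lambda>w x. T x - slice_scale rmult i w x"
  have "(norm z)\<^sup>2 = (norm q)\<^sup>2"
    unfolding norm_quat_square [of q] by (simp add: z cmod_power2)
  then have norm: "norm z = norm q" by simp
  have Q: "Q_op T q = ?A z \<circ> ?A (cnj z)"
    using Q_op_factor [OF i T, of z q] norm by (simp add: z)
  \<comment> \<open>Factoring with \<open>cnj z\<close> in place of \<open>z\<close> gives the
    reversed product, again equal to \<open>Q_op T q\<close>.\<close>
  have comm: "?A z \<circ> ?A (cnj z) = ?A (cnj z) \<circ> ?A z"
    using Q_op_factor [OF i T, of "cnj z" q] norm unfolding Q by (simp add: z)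
  have mem: "?A w \<in> ?\<B>" for w
    by (intro complex_bounded_ops_diff_scale complex_bounded_ops_slice i T)
  have "invertible_in (right_bounded_ops rmult) (Q_op T q) \<longleftrightarrow> invertible_in ?\<B> (?A z \<circ> ?A (cnj z))"
    using invertible_in_right_iff_slice [OF i Q_op_right_bounded [OF T, of q]] unfolding Q .
  also have "\<dots> \<longleftrightarrow> invertible_in ?\<B> (?A z) \<and> invertible_in ?\<B> (?A (cnj z))"
    using complex_bounded_ops_comp mem mem comm by (rule invertible_in_comp_iff)
  finally show ?thesis
    by (simp add: S_spectrum_def complex_spectrum_def)
qed

end

theorem proposition3p8:
  fixes lmult :: "quat \<Rightarrow> 'a::banach \<Rightarrow> 'a"
    and rmult :: "'a \<Rightarrow> quat \<Rightarrow> 'a"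
    and T :: "'a \<Rightarrow> 'a"
    and i :: quat
  assumes "two_sided_quat_banach lmult rmult"
    and "T \<in> right_bounded_ops rmult"
    and "i \<in> imag_units"
  shows "S_spectrum rmult T =
    (\<Union>q \<in> slice i ` complex_spectrum (slice_scale rmult i) T. conj_sphere q)"
proof -
  interpret two_sided_quat_banach lmult rmult by fact
  show ?thesis
  proof (rule set_eqI)
    fix q
    show "q \<in> S_spectrum rmult T \<longleftrightarrow>
      q \<in> (\<Union>q \<in> slice i ` complex_spectrum (slice_scale rmult i) T. conj_sphere q)"
      \<comment> \<open>Each \<open>refl\<close> sets \<open>z\<close> to
        \<open>Complex (qRe q) (norm (qIm q))\<close>; both sides then say that \<open>z\<close> or
        \<open>cnj z\<close> lies in the complex spectrum.\<close>
      unfolding UN_iff bex_simps mem_S_spectrum_iff [OF assms(3,2) refl]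
        mem_conj_sphere_slice_iff [OF assms(3) refl]
      by blast
  qed
qed

end
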